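(* For all $\beta\in\mathbb R^\sigma$, $\tilde H(\mathcal E_\beta)\subset\operatorname{dom}s$ and $$\mathcal E_\beta=\bigcup_{u\in\tilde H(\mathcal E_\beta)}\mathcal E^u.$$ The sets $\mathcal E^u$, $u\in\tilde H(\mathcal E_\beta)$, are nonempty and disjoint.
   Context: Setting. For each $n\in\mathbb N$, $(\Omega_n,\mathcal F_n,P_n)$ is a probability space; $\sigma\ge1$ is an integer; $H_{n,1},\dots,H_{n,\sigma}:\Omega_n\to\mathbb R$ are bounded measurable functions; $a_n>0$ with $a_n\to\infty$. $\mathcal X$ is a Polish space, $Y_n:\Omega_n\to\mathcal X$ are random variables, and $\tilde H_1,\dots,\tilde H_\sigma:\mathcal X\to\mathbb R$ are bounded continuous functions such that $\lim_{n\to\infty}\sup_{\omega\in\Omega_n}|H_{n,i}(\omega)-\tilde H_i(Y_n(\omega))|=0$ for each $i$; $\tilde H:=(\tilde H_1,\dots,\tilde H_\sigma)$. With respect to $P_n$, $Y_n$ satisfies the large deviation principle on $\mathcal X$ with scaling constants $a_n$ and rate function $I:\mathcal X\to[0,\infty]$, where rate functions have compact level sets $\{I\le M\}$, $0\le M<\infty$ (in particular $\inf_{\mathcal X}I=0$). $\langle\cdot,\cdot\rangle$ is the Euclidean inner product. Definitions. Microcanonical entropy: $s(u):=-\inf\{I(x):x\in\mathcal X,\ \tilde H(x)=u\}\in[-\infty,0]$ for $u\in\mathbb R^\sigma$ (with $\inf\emptyset=\infty$); $\operatorname{dom}s:=\{u: s(u)>-\infty\}$. Canonical equilibrium macrostates,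 for $\beta\in\mathbb R^\sigma$: $\mathcal E_\beta:=\{x\in\mathcal X: I(x)+\langle\beta,\tilde H(x)\rangle=\inf_{y\in\mathcal X}\{I(y)+\langle\beta,\tilde H(y)\rangle\}\}$. Microcanonical equilibrium macrostates: $\mathcal E^u:=\{x\in\mathcal X:\tilde H(x)=u,\ I(x)=-s(u)\}$ for $u\in\operatorname{dom}s$, and $\mathcal E^u:=\emptyset$ for $u\notin\operatorname{dom}s$. $\tilde H(\mathcal E_\beta)$ denotes the image of $\mathcal E_\beta$ under $\tilde H$. *)

theory Defs
  imports "HOL-Probability.Probability"
begin

text \<open>
  A Polish state space is rendered by the class \<open>polish_space\<close>, of which only the topology is
  used.  Extended values live in \<^typ>\<open>ereal\<close>, where an infimum over the empty set is \<open>\<infinity>\<close>.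
\<close>

text \<open>Only finite levels count: the set where \<open>I \<le> \<infinity>\<close> need not be compact.\<close>

definition rate_function :: "('x::topological_space \<Rightarrow> ereal) \<Rightarrow> bool" where
  "rate_function I \<longleftrightarrow>
     (\<forall>x. 0 \<le> I x) \<and> (\<forall>M::real. 0 \<le> M \<longrightarrow> compact {x. I x \<le> ereal M})"

text \<open>Logarithm of a probability with \<open>log 0 = -\<infinity>\<close>; HOL's real \<open>ln\<close> has \<open>ln 0 = 0\<close>.\<close>

definition log_prob :: "real \<Rightarrow> ereal" where
  "log_prob p = (if p = 0 then - \<infinity> else ereal (ln p))"

definition large_deviation_principle ::
  "(nat \<Rightarrow> 'w measure) \<Rightarrow> (nat \<Rightarrow> 'w \<Rightarrow> 'x::topological_space) \<Rightarrow> (nat \<Rightarrow> real)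
     \<Rightarrow> ('x \<Rightarrow> ereal) \<Rightarrow> bool" where
  "large_deviation_principle P Y a I \<longleftrightarrow>
     rate_function I \<and>
     (\<forall>F. closed F \<longrightarrow>
        limsup (\<lambda>n. ereal (1 / a n) * log_prob (\<P>(\<omega> in P n. Y n \<omega> \<in> F))) \<le> - (INF x\<in>F. I x)) \<and>
     (\<forall>G. open G \<longrightarrow>
        liminf (\<lambda>n. ereal (1 / a n) * log_prob (\<P>(\<omega> in P n. Y n \<omega> \<in> G))) \<ge> - (INF x\<in>G. I x))"

definition vec_of :: "('s \<Rightarrow> 'x \<Rightarrow> real) \<Rightarrow> 'x \<Rightarrow> real ^ 's::finite" where
  "vec_of H x = (\<chi> i. H i x)"

text \<open>In the following, \<open>H\<close> is the vector-valued representation function.\<close>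

definition micro_entropy :: "('x \<Rightarrow> ereal) \<Rightarrow> ('x \<Rightarrow> real ^ 's::finite) \<Rightarrow> real ^ 's \<Rightarrow> ereal" where
  "micro_entropy I H u = - (INF x\<in>{x. H x = u}. I x)"

definition dom_entropy :: "('x \<Rightarrow> ereal) \<Rightarrow> ('x \<Rightarrow> real ^ 's::finite) \<Rightarrow> (real ^ 's) set" where
  "dom_entropy I H = {u. micro_entropy I H u > - \<infinity>}"

definition canonical_macrostates ::
  "('x \<Rightarrow> ereal) \<Rightarrow> ('x \<Rightarrow> real ^ 's::finite) \<Rightarrow> real ^ 's \<Rightarrow> 'x set" where
  "canonical_macrostates I H \<beta> =
     {x. I x + ereal (\<beta> \<bullet> H x) = (INF y. I y + ereal (\<beta> \<bullet> H y))}"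

definition microcanonical_macrostates ::
  "('x \<Rightarrow> ereal) \<Rightarrow> ('x \<Rightarrow> real ^ 's::finite) \<Rightarrow> real ^ 's \<Rightarrow> 'x set" where
  "microcanonical_macrostates I H u =
     (if u \<in> dom_entropy I H then {x. H x = u \<and> I x = - micro_entropy I H u} else {})"

end

theory Submission
  imports Defs
begin

text \<open>
  On a level set of the representation function \<open>H\<close> the canonical functional
  \<open>I + \<langle>\<beta>, H\<rangle>\<close> differs from \<open>I\<close> only by a real constant.  A canonical equilibrium
  macrostate \<open>x\<close>, being a global minimizer of the functional, therefore minimizes \<open>I\<close> on its own
  level set (lemma \<open>micro_entropy_canonical\<close>); and any other minimizer of \<open>I\<close> on that level set
  gives the functional the same value as \<open>x\<close> and is canonical as well.  So the part of the
  canonical set at energy \<open>u = H x\<close> is exactly the microcanonical set at \<open>u\<close>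
  (lemma \<open>microcanonical_eq_canonical_at_energy\<close>), and the asserted decomposition is the partition
  of the canonical set into its intersections with the level sets of \<open>H\<close>.

  That such energies lie in the domain of the entropy requires \<open>I\<close> to be finite at canonical
  macrostates.  It is so as soon as \<open>I\<close> is finite somewhere, which follows from the upper large
  deviation bound for the whole space, an event of probability one
  (lemma \<open>large_deviation_rate_finite_somewhere\<close>).
\<close>

text \<open>
  For the whole space all the scaled logarithms are \<open>0\<close>, so the upper bound reads
  \<open>0 \<le> - inf I\<close>, which excludes \<open>I = \<infinity>\<close> everywhere.
\<close>

lemma large_deviation_rate_finite_somewhere:
  fixes I :: "'x::topological_space \<Rightarrow> ereal"
  assumes "large_deviation_principle P Y a I" and "\<And>n. prob_space (P n)"
  shows "\<exists>x. I x < \<infinity>"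
proof -
  have "log_prob (\<P>(\<omega> in P n. Y n \<omega> \<in> UNIV)) = 0" for n
    by (simp add: log_prob_def prob_space.prob_space[OF assms(2)])
  moreover have "limsup (\<lambda>n. ereal (1 / a n) * log_prob (\<P>(\<omega> in P n. Y n \<omega> \<in> UNIV)))
      \<le> - (INF x. I x)"
    using assms(1) unfolding large_deviation_principle_def by blast
  ultimately have "0 \<le> - (INF x. I x)"
    by (simp add: Limsup_const)
  then have "(INF x. I x) < \<infinity>"
    by (cases "INF x. I x") auto
  then show ?thesis
    unfolding INF_less_iff by blast
qed

lemma canonical_macrostates_le:
  assumes "x \<in> canonical_macrostates I H \<beta>"
  shows "I x + ereal (\<beta> \<bullet> H x) \<le> I y + ereal (\<beta> \<bullet> H y)"
  using assms INF_lower[OF UNIV_I, of "\<lambda>y. I y + ereal (\<beta> \<bullet> H y)" y]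
  by (simp add: canonical_macrostates_def)

lemma micro_entropy_canonical:
  assumes "x \<in> canonical_macrostates I H \<beta>"
  shows "micro_entropy I H (H x) = - I x"
proof -
  have "I x \<le> I y" if "H y = H x" for y
    using canonical_macrostates_le[OF assms, of y] that
    by (simp add: ereal_add_le_add_iff2)
  then have "(INF y\<in>{y. H y = H x}. I y) = I x"
    by (intro antisym INF_lower INF_greatest) auto
  then show ?thesis
    by (simp add: micro_entropy_def)
qed

lemma canonical_energy_in_dom_entropy:
  assumes "x \<in> canonical_macrostates I H \<beta>" and "I z < \<infinity>"
  shows "H x \<in> dom_entropy I H"
proof -
  have "I x + ereal (\<beta> \<bullet> H x) < \<infinity>"
    using canonical_macrostates_le[OF assms(1), of z] assms(2)
    by (auto intro: le_less_trans)
  then have "I x \<noteq> \<infinity>"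
    by auto
  then show ?thesis
    by (simp add: dom_entropy_def micro_entropy_canonical[OF assms(1)] ereal_uminus_eq_reorder)
qed

text \<open>
  A minimizer \<open>y\<close> of \<open>I\<close> on the level set of a canonical \<open>x\<close> satisfies \<open>I y = I x\<close>, hence gives
  the canonical functional the same, minimal value.
\<close>

lemma microcanonical_eq_canonical_at_energy:
  assumes "x \<in> canonical_macrostates I H \<beta>" and "H x \<in> dom_entropy I H"
  shows "microcanonical_macrostates I H (H x) = {y \<in> canonical_macrostates I H \<beta>. H y = H x}"
proof (intro subset_antisym subsetI)
  fix y
  assume "y \<in> microcanonical_macrostates I H (H x)"
  then have "H y = H x" "I y = I x"
    using assms(2)
    by (simp_all add: microcanonical_macrostates_def micro_entropy_canonical[OF assms(1)])
  then show "y \<in> {y \<in> canonical_macrostates I H \<beta>. H y = H x}"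
    using assms(1) by (simp add: canonical_macrostates_def)
next
  fix y
  assume "y \<in> {y \<in> canonical_macrostates I H \<beta>. H y = H x}"
  then show "y \<in> microcanonical_macrostates I H (H x)"
    using assms(2) micro_entropy_canonical[of y I H \<beta>]
    by (simp add: microcanonical_macrostates_def)
qed

theorem theorem4p6:
  fixes P :: "nat \<Rightarrow> 'w measure"
    and H :: "nat \<Rightarrow> 's::finite \<Rightarrow> 'w \<Rightarrow> real"
    and a :: "nat \<Rightarrow> real"
    and Y :: "nat \<Rightarrow> 'w \<Rightarrow> 'x::polish_space"
    and Ht :: "'s \<Rightarrow> 'x \<Rightarrow> real"
    and I :: "'x \<Rightarrow> ereal"
    and \<beta> :: "real ^ 's"
  assumes "\<And>n. prob_space (P n)"
    and "\<And>n i. H n i \<in> borel_measurable (P n)"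
    and "\<And>n i. bounded (H n i ` space (P n))"
    and "\<And>n. 0 < a n"
    and "filterlim a at_top sequentially"
    and "\<And>n. Y n \<in> borel_measurable (P n)"
    and "\<And>i. continuous_on UNIV (Ht i)"
    and "\<And>i. bounded (range (Ht i))"
    and "\<And>i. (\<lambda>n. SUP \<omega>\<in>space (P n). \<bar>H n i \<omega> - Ht i (Y n \<omega>)\<bar>) \<longlonglongrightarrow> 0"
    and "large_deviation_principle P Y a I"
  shows "vec_of Ht ` canonical_macrostates I (vec_of Ht) \<beta> \<subseteq> dom_entropy I (vec_of Ht)
    \<and> canonical_macrostates I (vec_of Ht) \<beta> =
        (\<Union>u \<in> vec_of Ht ` canonical_macrostates I (vec_of Ht) \<beta>.
           microcanonical_macrostates I (vec_of Ht) u)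
    \<and> (\<forall>u \<in> vec_of Ht ` canonical_macrostates I (vec_of Ht) \<beta>.
           microcanonical_macrostates I (vec_of Ht) u \<noteq> {})
    \<and> disjoint_family_on (microcanonical_macrostates I (vec_of Ht))
        (vec_of Ht ` canonical_macrostates I (vec_of Ht) \<beta>)"
proof -
  let ?H = "vec_of Ht"
  let ?C = "canonical_macrostates I ?H \<beta>"
  obtain z where "I z < \<infinity>"
    using large_deviation_rate_finite_somewhere[OF assms(10) assms(1)] by blast
  then have dom: "?H x \<in> dom_entropy I ?H" if "x \<in> ?C" for x
    using canonical_energy_in_dom_entropy[OF that] by blast
  have micro: "microcanonical_macrostates I ?H (?H x) = {y \<in> ?C. ?H y = ?H x}" if "x \<in> ?C" for x
    using microcanonical_eq_canonical_at_energy[OF that dom[OF that]] .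
  show ?thesis
  proof (intro conjI)
    show "?H ` ?C \<subseteq> dom_entropy I ?H"
      using dom by blast
    show "?C = (\<Union>u \<in> ?H ` ?C. microcanonical_macrostates I ?H u)"
      using micro by auto
    show "\<forall>u \<in> ?H ` ?C. microcanonical_macrostates I ?H u \<noteq> {}"
      using micro by auto
    show "disjoint_family_on (microcanonical_macrostates I ?H) (?H ` ?C)"
      using micro by (auto simp: disjoint_family_on_def)
  qed
qed

end
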